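(* Assume: (i) for each $i\in\mathcal H$, $\mathcal X_i\subseteq\mathbb R^{n_i}$ is nonempty, closed and convex, $Q_i$ is symmetric positive semidefinite, $\phi_i(z_i)=\tfrac12 z_i^\top Q_i z_i+q_i^\top z_i+I_{\mathcal X_i}(z_i)$ is proper, closed and convex, and the price enters the follower objective affinely through $\lambda_i(\delta_i)^\top z_i$; (ii) for every $\delta\in\mathcal D$ and each $i\in\mathcal H$ the follower problem $\min_{z_i}\{\phi_i(z_i)+\lambda_i(\delta_i)^\top z_i\}$ has at least one optimal solution; (iii) the price set $\mathcal D$ is nonempty, closed and convex, and the leader's objective $F$ is proper, closed and convex in its explicit decision variables. If $F$ is convex in the explicit variables $(x,\delta)$ of the subproblem below and each map $\delta_i\mapsto\lambda_i(\delta_i)$ is affine, then for every iteration $k$ the subproblem $$\min_{x,\delta}\ F(x,\delta)+\rho_k\sum_{i\in\mathcal H}\widehat D_i^k\bigl(x_i,\lambda_i(\delta_i)\bigr)\quad\text{s.t.}\quad \delta\in\mathcal D$$ is a convex optimization problem, i.e. its objective is a convex (extended-real-valued) function of $(x,\delta)$ and its feasible set is convex.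
   Context: $\mathcal H$ is a finite set of followers and $\mathcal T$ a finite set of time periods; $\delta=(\delta_i)_{i\in\mathcal H}$ with $\delta_i\in\mathbb R^{\mathcal T}$ is the leader's price vector, $x=(x_i)_{i\in\mathcal H}$ with $x_i\in\mathbb R^{n_i}$ the follower responses, $\lambda_i(\delta_i)\in\mathbb R^{n_i}$ the price-induced linear coefficient vector of follower $i$, $q_i\in\mathbb R^{n_i}$, and $\rho_k>0$ a penalty parameter. $I_{\mathcal X}$ denotes the indicator function ($0$ on $\mathcal X$, $+\infty$ off $\mathcal X$) and $\phi^*(y)=\sup_{x}\{y^\top x-\phi(x)\}$ the convex conjugate. Define $$h_i(x_i,\lambda_i)=\phi_i(x_i)+\phi_i^*(-\lambda_i)+\tfrac14\|x_i+\lambda_i\|^2,\qquad o_i(x_i,\lambda_i)=\tfrac14\|x_i-\lambda_i\|^2$$ for $x_i,\lambda_i\in\mathbb R^{n_i}$ (Euclidean norm). Given the current iterate $(x^k,\delta^k)$ with $\delta^k\in\mathcal D$ and $\lambda_i^k=\lambda_i(\delta_i^k)$, the majorized gap at iteration $k$ is $$\widehat D_i^k(x_i,\lambda_i)=h_i(x_i,\lambda_i)-o_i(x_i^k,\lambda_i^k)-\bigl\langle\nabla o_i(x_i^k,\lambda_i^k),\,(x_i-x_i^k,\ \lambda_i-\lambda_i^k)\bigr\rangle .$$ These subproblems are those solved at each iteration of the sequential convex approximation algorithm, whose next iterate $(x^{k+1},\delta^{k+1})$ is a minimizer of the subproblem at iteration $k$. *)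

theory Defs
  imports "HOL-Analysis.Analysis"
begin

text \<open>
  Types: \<open>'h\<close> indexes the followers, \<open>'t\<close> the time periods, and \<open>'n\<close> is a common pool of
  coordinates.  Since the dimensions of the follower spaces may differ, the space of follower
  \<open>i\<close> is the Euclidean space with coordinate set \<open>J i \<subseteq> UNIV :: 'n set\<close>, realized as a
  coordinate subspace of \<open>real^'n\<close>; its dimension is \<open>card (J i)\<close>.  As \<open>'n\<close> is an arbitrary
  finite type, every finite family of dimensions arises in this way.  Inner product and norm
  are inherited from \<open>real^'n\<close>.
\<close>

definition coords :: "'n set \<Rightarrow> (real^'n::finite) set" where
  "coords I = {v. \<forall>j. j \<notin> I \<longrightarrow> v $ j = 0}"

definition responses :: "('h \<Rightarrow> 'n set) \<Rightarrow> (real^'n::finite^'h::finite) set" where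
  "responses J = {x. \<forall>i. x $ i \<in> coords (J i)}"

text \<open>Square matrices with rows and columns indexed by \<open>I\<close>, padded with zeros.\<close>

definition coord_matrices :: "'n set \<Rightarrow> (real^'n::finite^'n) set" where
  "coord_matrices I = {A. \<forall>a b. a \<notin> I \<or> b \<notin> I \<longrightarrow> A $ a $ b = 0}"

definition sym_psd_on :: "'n set \<Rightarrow> real^'n::finite^'n \<Rightarrow> bool" where
  "sym_psd_on I A \<longleftrightarrow>
     A \<in> coord_matrices I \<and> transpose A = A \<and> (\<forall>v\<in>coords I. 0 \<le> v \<bullet> (A *v v))"

definition affine_map :: "('a::real_vector \<Rightarrow> 'b::real_vector) \<Rightarrow> bool" where
  "affine_map f \<longleftrightarrow> (\<exists>L c. linear L \<and> (\<forall>x. f x = L x + c))"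

text \<open>
  Convex analysis of extended-real-valued functions on a Euclidean space \<open>S\<close>, which is given as
  a (closed) linear subspace of an ambient type; values outside \<open>S\<close> are irrelevant.  Convexity
  and closedness are those of the epigraph, a subset of \<open>S \<times> \<real>\<close>; this avoids \<open>\<infinity> - \<infinity>\<close>.
\<close>

definition ext_epigraph :: "'a set \<Rightarrow> ('a \<Rightarrow> ereal) \<Rightarrow> ('a \<times> real) set" where
  "ext_epigraph S f = {(x, t). x \<in> S \<and> f x \<le> ereal t}"

definition ext_convex_on :: "'a::real_vector set \<Rightarrow> ('a \<Rightarrow> ereal) \<Rightarrow> bool" where
  "ext_convex_on S f \<longleftrightarrow> convex (ext_epigraph S f)"

definition ext_closed_on :: "'a::topological_space set \<Rightarrow> ('a \<Rightarrow> ereal) \<Rightarrow> bool" where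
  "ext_closed_on S f \<longleftrightarrow> closed (ext_epigraph S f)"

definition ext_proper_on :: "'a set \<Rightarrow> ('a \<Rightarrow> ereal) \<Rightarrow> bool" where
  "ext_proper_on S f \<longleftrightarrow> (\<forall>x\<in>S. f x \<noteq> -\<infinity>) \<and> (\<exists>x\<in>S. f x \<noteq> \<infinity>)"

definition ext_indicator :: "'a set \<Rightarrow> 'a \<Rightarrow> ereal" where
  "ext_indicator X x = (if x \<in> X then 0 else \<infinity>)"

definition convex_conjugate :: "'a::real_inner set \<Rightarrow> ('a \<Rightarrow> ereal) \<Rightarrow> 'a \<Rightarrow> ereal" where
  "convex_conjugate S f y = (SUP x\<in>S. ereal (y \<bullet> x) - f x)"

definition gradient :: "('a::real_inner \<Rightarrow> real) \<Rightarrow> 'a \<Rightarrow> 'a" where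
  "gradient f z = (THE g. GDERIV f z :> g)"

definition h_fun ::
  "'n set \<Rightarrow> (real^'n::finite \<Rightarrow> ereal) \<Rightarrow> (real^'n) \<times> (real^'n) \<Rightarrow> ereal" where
  "h_fun I \<phi> = (\<lambda>(x, l).
     \<phi> x + convex_conjugate (coords I) \<phi> (- l) + ereal (1/4 * (norm (x + l))\<^sup>2))"

definition o_fun :: "(real^'n::finite) \<times> (real^'n) \<Rightarrow> real" where
  "o_fun = (\<lambda>(x, l). 1/4 * (norm (x - l))\<^sup>2)"

text \<open>
  The gradient below is taken in \<open>real^'n \<times> real^'n\<close>.  At points whose two components lie in
  \<open>coords I\<close> it lies in \<open>coords I \<times> coords I\<close> (see \<open>gradient_o_fun\<close>), so it is also the
  gradient in the follower's own space.
\<close>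

lemma gradient_o_fun:
  fixes a b :: "real^'n::finite"
  shows "GDERIV o_fun (a, b) :> gradient o_fun (a, b)"
    and "gradient o_fun (a, b) = ((1/2) *\<^sub>R (a - b), (1/2) *\<^sub>R (b - a))"
proof -
  let ?g = "((1/2) *\<^sub>R (a - b), (1/2) *\<^sub>R (b - a))"
  have o: "(o_fun :: (real^'n) \<times> (real^'n) \<Rightarrow> real)
      = (\<lambda>z. 1/4 * ((fst z - snd z) \<bullet> (fst z - snd z)))"
    by (auto simp: o_fun_def fun_eq_iff power2_norm_eq_inner)
  have D: "GDERIV o_fun (a, b) :> ?g"
    unfolding gderiv_def o
    by (rule derivative_eq_intros refl)+
       (auto simp: fun_eq_iff inner_diff_left inner_diff_right inner_commute algebra_simps)
  have U: "g = ?g" if "GDERIV o_fun (a, b) :> g" for g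
    using has_derivative_unique[OF that[unfolded gderiv_def] D[unfolded gderiv_def]]
    by (metis vector_eq_ldot)
  show "gradient o_fun (a, b) = ?g"
    unfolding gradient_def using D U by (rule the_equality)
  then show "GDERIV o_fun (a, b) :> gradient o_fun (a, b)"
    using D by simp
qed

text \<open>\<open>(xk, lk)\<close> is the linearization point.\<close>

definition maj_gap ::
  "'n set \<Rightarrow> (real^'n::finite \<Rightarrow> ereal) \<Rightarrow> real^'n \<Rightarrow> real^'n \<Rightarrow> real^'n \<Rightarrow> real^'n \<Rightarrow> ereal" where
  "maj_gap I \<phi> xk lk x l =
     h_fun I \<phi> (x, l) - ereal (o_fun (xk, lk))
       - ereal (gradient o_fun (xk, lk) \<bullet> (x - xk, l - lk))"

definition sub_objective ::
  "('h \<Rightarrow> 'n set) \<Rightarrow> ('h \<Rightarrow> real^'n::finite \<Rightarrow> ereal) \<Rightarrow> ('h \<Rightarrow> real^'t::finite \<Rightarrow> real^'n)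
   \<Rightarrow> ((real^'n^'h::finite) \<times> (real^'t^'h) \<Rightarrow> ereal) \<Rightarrow> real
   \<Rightarrow> (real^'n^'h) \<times> (real^'t^'h) \<Rightarrow> (real^'n^'h) \<times> (real^'t^'h) \<Rightarrow> ereal" where
  "sub_objective J \<phi> lam F \<rho> = (\<lambda>(xk, \<delta>k) (x, \<delta>).
     F (x, \<delta>) + ereal \<rho> *
       (\<Sum>i\<in>UNIV. maj_gap (J i) (\<phi> i) (xk $ i) (lam i (\<delta>k $ i)) (x $ i) (lam i (\<delta> $ i))))"

definition sub_feasible ::
  "('h \<Rightarrow> 'n set) \<Rightarrow> (real^'t::finite^'h::finite) set
   \<Rightarrow> ((real^'n::finite^'h) \<times> (real^'t^'h)) set" where
  "sub_feasible J D = {(x, \<delta>). x \<in> responses J \<and> \<delta> \<in> D}"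

text \<open>
  \<open>it 0, \<dots>, it k\<close> are the iterates of a run of the sequential convex approximation algorithm
  that has reached iteration \<open>k\<close>; nothing is required of \<open>it j\<close> for \<open>j > k\<close>, so the subproblem
  at iteration \<open>k\<close> need not be solvable.
\<close>

definition sca_run ::
  "('h \<Rightarrow> 'n set) \<Rightarrow> ('h \<Rightarrow> real^'n::finite \<Rightarrow> ereal) \<Rightarrow> ('h \<Rightarrow> real^'t::finite \<Rightarrow> real^'n)
   \<Rightarrow> ((real^'n^'h::finite) \<times> (real^'t^'h) \<Rightarrow> ereal) \<Rightarrow> (real^'t^'h) set \<Rightarrow> (nat \<Rightarrow> real)
   \<Rightarrow> nat \<Rightarrow> (nat \<Rightarrow> (real^'n^'h) \<times> (real^'t^'h)) \<Rightarrow> bool" where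
  "sca_run J \<phi> lam F D \<rho> k it \<longleftrightarrow>
     it 0 \<in> sub_feasible J D \<and>
     (\<forall>j<k. is_arg_min (sub_objective J \<phi> lam F (\<rho> j) (it j))
               (\<lambda>p. p \<in> sub_feasible J D) (it (Suc j)))"

end

theory Submission
  imports Defs
begin

text \<open>
  The nonconvex part \<open>o_i\<close> of the gap enters the majorized gap only through its linearization, so
  up to an affine function of \<open>(x_i, \<lambda>_i)\<close> the majorized gap is
  \<open>h_i = \<phi>_i(x_i) + \<phi>_i\<^sup>*(-\<lambda>_i) + \<parallel>x_i + \<lambda>_i\<parallel>\<^sup>2 / 4\<close>.  This is jointly convex: a conjugate is a
  supremum of affine functions (\<open>ext_convex_on_conjugate\<close>) and the squared norm is convex.  As the
  \<open>\<lambda>_i\<close> are affine in the prices, substituting \<open>\<lambda>_i(\<delta>_i)\<close> preserves convexity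
  (\<open>ext_convex_on_affine_comp\<close>), and so do the sum over the followers, the positive penalty factor
  and the addition of \<open>F\<close>.

  The values \<open>\<plusminus>\<infinity>\<close> fit into this argument: as \<open>\<infinity> + (-\<infinity>) = \<infinity>\<close> in \<^typ>\<open>ereal\<close>, a sum bounded above by a
  real number has summands below \<open>\<infinity>\<close>, and this makes sums of convex functions convex
  (\<open>ext_convex_on_add\<close>).
\<close>

section \<open>Operations preserving extended-real-valued convexity\<close>

lemma ext_convex_onI:
  assumes "convex S"
    and "\<And>x y s t u v. \<lbrakk>x \<in> S; y \<in> S; f x \<le> ereal s; f y \<le> ereal t; 0 \<le> u; 0 \<le> v; u + v = 1\<rbrakk>
           \<Longrightarrow> f (u *\<^sub>R x + v *\<^sub>R y) \<le> ereal (u * s + v * t)"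
  shows "ext_convex_on S f"
  using assms unfolding ext_convex_on_def ext_epigraph_def convex_def by auto

lemma ext_convex_onD:
  assumes "ext_convex_on S f" "x \<in> S" "y \<in> S" "f x \<le> ereal s" "f y \<le> ereal t"
    "0 \<le> u" "0 \<le> v" "u + v = 1"
  shows "f (u *\<^sub>R x + v *\<^sub>R y) \<le> ereal (u * s + v * t)"
proof -
  have "(x, s) \<in> ext_epigraph S f" "(y, t) \<in> ext_epigraph S f"
    using assms by (auto simp: ext_epigraph_def)
  then have "u *\<^sub>R (x, s) + v *\<^sub>R (y, t) \<in> ext_epigraph S f"
    using assms unfolding ext_convex_on_def by (blast intro: convexD)
  then show ?thesis
    by (simp add: ext_epigraph_def)
qed

lemma ext_convex_on_real:
  assumes "convex_on S f"
  shows "ext_convex_on S (\<lambda>x. ereal (f x))"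
proof (rule ext_convex_onI)
  show "convex S"
    using assms by (rule convex_on_imp_convex)
next
  fix x y s t and u v :: real
  assume *: "x \<in> S" "y \<in> S" "ereal (f x) \<le> ereal s" "ereal (f y) \<le> ereal t"
    "0 \<le> u" "0 \<le> v" "u + v = 1"
  have "f (u *\<^sub>R x + v *\<^sub>R y) \<le> u * f x + v * f y"
    using assms * by (simp add: convex_on_def)
  also have "\<dots> \<le> u * s + v * t"
    using * by (intro add_mono mult_left_mono) auto
  finally show "ereal (f (u *\<^sub>R x + v *\<^sub>R y)) \<le> ereal (u * s + v * t)"
    by simp
qed

lemma ext_convex_on_add:
  assumes S: "convex S" and f: "ext_convex_on S f" and g: "ext_convex_on S g"
  shows "ext_convex_on S (\<lambda>x. f x + g x)"
proof (rule ext_convex_onI[OF S])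
  fix x y s t and u v :: real
  assume *: "x \<in> S" "y \<in> S" "f x + g x \<le> ereal s" "f y + g y \<le> ereal t"
    and uv: "0 \<le> u" "0 \<le> v" "u + v = 1"
  \<comment> \<open>A summand \<open>-\<infinity>\<close> has every real number as an upper bound, in particular the one that the
    other summand leaves.\<close>
  have split: "\<exists>a b. f z \<le> ereal a \<and> g z \<le> ereal b \<and> a + b \<le> r"
    if "f z + g z \<le> ereal r" for z r
  proof (cases "f z")
    case (real a)
    then show ?thesis
      using that by (intro exI[of _ a] exI[of _ "r - a"]) (cases "g z", auto)
  next
    case MInf
    then show ?thesis
    proof (cases "g z")
      case (real b)
      then show ?thesis
        using MInf by (intro exI[of _ "r - b"] exI[of _ b]) auto
    next
      case MInf
      then show ?thesis
        using \<open>f z = -\<infinity>\<close> by (intro exI[of _ r] exI[of _ 0]) auto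
    qed (use that MInf in auto)
  qed (use that in auto)
  obtain a b where ab: "f x \<le> ereal a" "g x \<le> ereal b" "a + b \<le> s"
    using split * by blast
  obtain c d where cd: "f y \<le> ereal c" "g y \<le> ereal d" "c + d \<le> t"
    using split * by blast
  have "f (u *\<^sub>R x + v *\<^sub>R y) + g (u *\<^sub>R x + v *\<^sub>R y)
      \<le> ereal (u * a + v * c) + ereal (u * b + v * d)"
    using * ab cd uv by (intro add_mono ext_convex_onD[OF f] ext_convex_onD[OF g])
  also have "\<dots> = ereal (u * (a + b) + v * (c + d))"
    by (simp add: algebra_simps)
  also have "\<dots> \<le> ereal (u * s + v * t)"
    using ab cd uv by (simp add: add_mono mult_left_mono)
  finally show "f (u *\<^sub>R x + v *\<^sub>R y) + g (u *\<^sub>R x + v *\<^sub>R y) \<le> ereal (u * s + v * t)" .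
qed

lemma ext_convex_on_sum:
  assumes S: "convex S"
    and "\<And>i. i \<in> I \<Longrightarrow> ext_convex_on S (f i)"
  shows "ext_convex_on S (\<lambda>x. \<Sum>i\<in>I. f i x)"
proof -
  have zero: "ext_convex_on S (\<lambda>x. 0)"
    using ext_convex_on_real[of S "\<lambda>x. 0"] S by (simp add: convex_on_const zero_ereal_def)
  show ?thesis
    using assms(2)
  proof (induction I rule: infinite_finite_induct)
    case (insert i I)
    then show ?case
      using ext_convex_on_add[OF S, of "f i" "\<lambda>x. \<Sum>i\<in>I. f i x"]
      by simp
  qed (use zero in auto)
qed

lemma ext_convex_on_cmult:
  assumes S: "convex S" and f: "ext_convex_on S f" and c: "0 < c"
  shows "ext_convex_on S (\<lambda>x. ereal c * f x)"
proof (rule ext_convex_onI[OF S])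
  fix x y s t and u v :: real
  assume *: "x \<in> S" "y \<in> S" "ereal c * f x \<le> ereal s" "ereal c * f y \<le> ereal t"
    and uv: "0 \<le> u" "0 \<le> v" "u + v = 1"
  have scale: "ereal c * a \<le> ereal r \<longleftrightarrow> a \<le> ereal (r / c)" for a r
    using c by (cases a) (auto simp: field_simps)
  have "f (u *\<^sub>R x + v *\<^sub>R y) \<le> ereal (u * (s / c) + v * (t / c))"
    using * uv by (intro ext_convex_onD[OF f]) (simp_all add: scale)
  then show "ereal c * f (u *\<^sub>R x + v *\<^sub>R y) \<le> ereal (u * s + v * t)"
    by (simp add: scale add_divide_distrib)
qed

lemma affine_map_combination:
  assumes "affine_map A" "u + v = 1"
  shows "A (u *\<^sub>R x + v *\<^sub>R y) = u *\<^sub>R A x + v *\<^sub>R A y"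
proof -
  obtain L c where L: "linear L" and A: "\<And>x. A x = L x + c"
    using assms(1) unfolding affine_map_def by blast
  have "u *\<^sub>R c + v *\<^sub>R c = c"
    using assms(2) by (metis scaleR_add_left scaleR_one)
  then show ?thesis
    by (simp add: A linear_add[OF L] linear_scale[OF L] algebra_simps)
qed

lemma affine_map_linear: "linear L \<Longrightarrow> affine_map L"
  unfolding affine_map_def by (rule exI[of _ L], rule exI[of _ 0]) simp

lemma affine_map_comp:
  assumes "affine_map A" "affine_map B"
  shows "affine_map (\<lambda>x. A (B x))"
proof -
  obtain L c M d where L: "linear L" and A: "\<And>x. A x = L x + c"
    and M: "linear M" and B: "\<And>x. B x = M x + d"
    using assms unfolding affine_map_def by blast
  have "linear (L \<circ> M)"
    using M L by (rule linear_compose)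
  moreover have "A (B x) = (L \<circ> M) x + (L d + c)" for x
    by (simp add: A B linear_add[OF L])
  ultimately show ?thesis
    unfolding affine_map_def by blast
qed

lemma affine_map_Pair:
  assumes "affine_map A" "affine_map B"
  shows "affine_map (\<lambda>x. (A x, B x))"
proof -
  obtain L c M d where L: "linear L" and A: "\<And>x. A x = L x + c"
    and M: "linear M" and B: "\<And>x. B x = M x + d"
    using assms unfolding affine_map_def by blast
  have "linear (\<lambda>x. (L x, M x))"
    using L M by (simp add: linear_iff)
  moreover have "(A x, B x) = (L x, M x) + (c, d)" for x
    by (simp add: A B)
  ultimately show ?thesis
    unfolding affine_map_def by blast
qed

lemma ext_convex_on_affine_comp:
  assumes S: "convex S" and A: "affine_map A" "A ` S \<subseteq> T" and f: "ext_convex_on T f"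
  shows "ext_convex_on S (\<lambda>x. f (A x))"
proof (rule ext_convex_onI[OF S])
  fix x y s t and u v :: real
  assume "x \<in> S" "y \<in> S" "f (A x) \<le> ereal s" "f (A y) \<le> ereal t"
    "0 \<le> u" "0 \<le> v" "u + v = 1"
  then show "f (A (u *\<^sub>R x + v *\<^sub>R y)) \<le> ereal (u * s + v * t)"
    using A(2) by (auto simp: affine_map_combination[OF A(1)] intro!: ext_convex_onD[OF f])
qed

section \<open>Convex conjugates\<close>

text \<open>
  A real upper bound of the supremum is one of every \<open>y \<mapsto> \<langle>y, x\<rangle> - f x\<close>, which is affine if \<open>f x\<close> is
  finite and constantly \<open>\<infinity>\<close> or \<open>-\<infinity>\<close> otherwise.
\<close>

lemma ext_convex_on_conjugate: "ext_convex_on UNIV (convex_conjugate S f)"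
proof (rule ext_convex_onI)
  fix y z s t and u v :: real
  assume le: "convex_conjugate S f y \<le> ereal s" "convex_conjugate S f z \<le> ereal t"
    and uv: "0 \<le> u" "0 \<le> v" "u + v = 1"
  show "convex_conjugate S f (u *\<^sub>R y + v *\<^sub>R z) \<le> ereal (u * s + v * t)"
    unfolding convex_conjugate_def
  proof (rule SUP_least)
    fix x assume "x \<in> S"
    then have bounds: "ereal (y \<bullet> x) - f x \<le> ereal s" "ereal (z \<bullet> x) - f x \<le> ereal t"
      using le by (auto simp: convex_conjugate_def SUP_le_iff)
    show "ereal ((u *\<^sub>R y + v *\<^sub>R z) \<bullet> x) - f x \<le> ereal (u * s + v * t)"
    proof (cases "f x")
      case (real r)
      have "u * (y \<bullet> x - r) + v * (z \<bullet> x - r) \<le> u * s + v * t"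
        using bounds uv real by (intro add_mono mult_left_mono) auto
      moreover have "u * (y \<bullet> x - r) + v * (z \<bullet> x - r) = (u *\<^sub>R y + v *\<^sub>R z) \<bullet> x - (u + v) * r"
        by (simp add: inner_add_left algebra_simps)
      ultimately show ?thesis
        using real uv by simp
    qed (use bounds in auto)
  qed
qed simp

section \<open>The majorized gap\<close>

lemma convex_on_norm_power2:
  fixes S :: "'a::real_normed_vector set"
  assumes "convex S"
  shows "convex_on S (\<lambda>z. (norm z)\<^sup>2)"
proof (intro convex_onI assms)
  fix t :: real and x y :: 'a
  assume t: "0 < t" "t < 1"
  have "norm ((1 - t) *\<^sub>R x + t *\<^sub>R y) \<le> (1 - t) * norm x + t * norm y"
    using norm_triangle_ineq[of "(1 - t) *\<^sub>R x" "t *\<^sub>R y"] t by simp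
  then have "(norm ((1 - t) *\<^sub>R x + t *\<^sub>R y))\<^sup>2 \<le> ((1 - t) * norm x + t * norm y)\<^sup>2"
    by (simp add: power_mono)
  also have "\<dots> \<le> (1 - t) * (norm x)\<^sup>2 + t * (norm y)\<^sup>2"
    using convex_onD[OF convex_power2, of t "norm x" "norm y"] t by simp
  finally show "(norm ((1 - t) *\<^sub>R x + t *\<^sub>R y))\<^sup>2 \<le> (1 - t) * (norm x)\<^sup>2 + t * (norm y)\<^sup>2" .
qed

text \<open>
  This is the finite part of the majorized gap, with \<open>c\<close> and \<open>g\<close> for the value and the gradient of
  \<open>o\<close> at \<open>(a, b)\<close>; a linearization is affine whatever its coefficients are, and subtracting an
  affine function from the convex quadratic leaves it convex.
\<close>

lemma ext_convex_on_quadratic_minus_affine: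
  fixes a b :: "'a::real_inner"
  shows "ext_convex_on UNIV
    (\<lambda>p. ereal (1/4 * (norm (fst p + snd p))\<^sup>2 - c - g \<bullet> (fst p - a, snd p - b)))"
proof -
  have "linear (\<lambda>p::'a \<times> 'a. fst p + snd p)"
    by (intro linear_compose_add bounded_linear.linear bounded_linear_fst bounded_linear_snd)
  then have "ext_convex_on UNIV (\<lambda>p::'a \<times> 'a. ereal ((norm (fst p + snd p))\<^sup>2))"
    by (intro ext_convex_on_affine_comp[OF _ affine_map_linear _
          ext_convex_on_real[OF convex_on_norm_power2[OF convex_UNIV]]]) auto
  then have quad: "ext_convex_on UNIV (\<lambda>p::'a \<times> 'a. ereal (1/4) * ereal ((norm (fst p + snd p))\<^sup>2))"
    by (intro ext_convex_on_cmult) auto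
  have "convex_on UNIV (\<lambda>p. - c - g \<bullet> (fst p - a, snd p - b))"
  proof (intro convex_onI convex_UNIV)
    fix t :: real and p r :: "'a \<times> 'a"
    have "(fst ((1 - t) *\<^sub>R p + t *\<^sub>R r) - a, snd ((1 - t) *\<^sub>R p + t *\<^sub>R r) - b)
        = (1 - t) *\<^sub>R (fst p - a, snd p - b) + t *\<^sub>R (fst r - a, snd r - b)"
      by (simp add: algebra_simps)
    then show "- c - g \<bullet> (fst ((1 - t) *\<^sub>R p + t *\<^sub>R r) - a, snd ((1 - t) *\<^sub>R p + t *\<^sub>R r) - b)
        \<le> (1 - t) * (- c - g \<bullet> (fst p - a, snd p - b)) + t * (- c - g \<bullet> (fst r - a, snd r - b))"
      by (simp only: inner_add_right inner_scaleR_right) (simp add: algebra_simps)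
  qed
  from ext_convex_on_add[OF convex_UNIV quad ext_convex_on_real[OF this]]
  show ?thesis
    by (simp add: algebra_simps)
qed

text \<open>
  Collecting the real-valued terms turns the extended-real differences in the majorized gap into a
  sum of three convex functions.
\<close>

lemma maj_gap_eq:
  "maj_gap I \<phi> a b x l = \<phi> x + convex_conjugate (coords I) \<phi> (- l)
     + ereal (1/4 * (norm (x + l))\<^sup>2 - o_fun (a, b) - gradient o_fun (a, b) \<bullet> (x - a, l - b))"
  unfolding maj_gap_def h_fun_def
  by (cases "\<phi> x"; cases "convex_conjugate (coords I) \<phi> (- l)") auto

lemma subspace_coords: "subspace (coords I)"
  by (auto simp: subspace_def coords_def)

lemma ext_convex_on_maj_gap:
  assumes "ext_convex_on (coords I) \<phi>"
  shows "ext_convex_on (coords I \<times> UNIV) (\<lambda>p. maj_gap I \<phi> a b (fst p) (snd p))"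
proof -
  let ?S = "coords I \<times> (UNIV :: (real^'a) set)"
  have S: "convex ?S"
    by (intro convex_Times subspace_imp_convex subspace_coords convex_UNIV)
  have "ext_convex_on ?S (\<lambda>p. \<phi> (fst p))"
    using assms
    by (intro ext_convex_on_affine_comp[OF S affine_map_linear]
          bounded_linear.linear[OF bounded_linear_fst]) auto
  moreover have "ext_convex_on ?S (\<lambda>p. convex_conjugate (coords I) \<phi> (- snd p))"
    by (intro ext_convex_on_affine_comp[OF S affine_map_linear _ ext_convex_on_conjugate]
          linear_compose_neg bounded_linear.linear[OF bounded_linear_snd]) auto
  moreover have "ext_convex_on ?S (\<lambda>p. ereal (1/4 * (norm (fst p + snd p))\<^sup>2 - o_fun (a, b)
      - gradient o_fun (a, b) \<bullet> (fst p - a, snd p - b)))"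
    using ext_convex_on_affine_comp[OF S affine_map_linear[OF linear_id] _
        ext_convex_on_quadratic_minus_affine[of "o_fun (a, b)" "gradient o_fun (a, b)" a b]]
    by simp
  ultimately show ?thesis
    unfolding maj_gap_eq
    by (intro ext_convex_on_add[OF S])
qed

lemma subspace_responses: "subspace (responses J)"
  by (auto simp: subspace_def responses_def coords_def)

section \<open>The subproblem\<close>

theorem proposition1:
  fixes J :: "'h::finite \<Rightarrow> 'n::finite set"
    and X :: "'h \<Rightarrow> (real^'n) set"
    and Q :: "'h \<Rightarrow> real^'n^'n"
    and q :: "'h \<Rightarrow> real^'n"
    and \<phi> :: "'h \<Rightarrow> real^'n \<Rightarrow> ereal"
    and lam :: "'h \<Rightarrow> real^'t::finite \<Rightarrow> real^'n"
    and D :: "(real^'t^'h) set"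
    and F :: "(real^'n^'h) \<times> (real^'t^'h) \<Rightarrow> ereal"
    and \<rho> :: "nat \<Rightarrow> real"
  assumes X: "\<And>i. X i \<subseteq> coords (J i) \<and> X i \<noteq> {} \<and> closed (X i) \<and> convex (X i)"
    and Q: "\<And>i. sym_psd_on (J i) (Q i)"
    and q: "\<And>i. q i \<in> coords (J i)"
    and phi: "\<And>i z. \<phi> i z = ereal (1/2 * (z \<bullet> (Q i *v z)) + q i \<bullet> z) + ext_indicator (X i) z"
    and phi_pcc: "\<And>i. ext_proper_on (coords (J i)) (\<phi> i) \<and> ext_closed_on (coords (J i)) (\<phi> i)
                      \<and> ext_convex_on (coords (J i)) (\<phi> i)"
    and lam: "\<And>i d. lam i d \<in> coords (J i)"
    and follower_solvable:
      "\<And>\<delta> i. \<delta> \<in> D \<Longrightarrow>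
         \<exists>z. is_arg_min (\<lambda>z. \<phi> i z + ereal (lam i (\<delta> $ i) \<bullet> z)) (\<lambda>z. z \<in> coords (J i)) z"
    and D: "D \<noteq> {}" "closed D" "convex D"
    and F: "ext_proper_on (responses J \<times> UNIV) F" "ext_closed_on (responses J \<times> UNIV) F"
           "ext_convex_on (responses J \<times> UNIV) F"
    and lam_affine: "\<And>i. affine_map (lam i)"
    and rho: "\<And>k. 0 < \<rho> k"
  shows "\<forall>k it. sca_run J \<phi> lam F D \<rho> k it \<longrightarrow>
           ext_convex_on (responses J \<times> UNIV) (sub_objective J \<phi> lam F (\<rho> k) (it k))
         \<and> convex (sub_feasible J D :: ((real^'n^'h) \<times> (real^'t^'h)) set)"
proof (intro allI impI conjI)
  fix k and it :: "nat \<Rightarrow> (real^'n^'h) \<times> (real^'t^'h)"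
  let ?S = "responses J \<times> (UNIV :: (real^'t^'h) set)"
  have S: "convex ?S"
    by (intro convex_Times subspace_imp_convex subspace_responses convex_UNIV)
  obtain xk \<delta>k where it: "it k = (xk, \<delta>k)"
    by (cases "it k")
  let ?gap = "\<lambda>i p. maj_gap (J i) (\<phi> i) (xk $ i) (lam i (\<delta>k $ i)) (fst p $ i) (lam i (snd p $ i))"
  have gap_convex: "ext_convex_on ?S (?gap i)" for i
  proof -
    have x_linear: "linear (\<lambda>p::(real^'n^'h) \<times> (real^'t^'h). fst p $ i)"
      and price_linear: "linear (\<lambda>p::(real^'n^'h) \<times> (real^'t^'h). snd p $ i)"
      by (simp_all add: linear_iff)
    have pair: "affine_map (\<lambda>p::(real^'n^'h) \<times> (real^'t^'h). (fst p $ i, lam i (snd p $ i)))"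
      using affine_map_linear[OF x_linear]
        affine_map_comp[OF lam_affine affine_map_linear[OF price_linear]]
      by (rule affine_map_Pair)
    have image: "(\<lambda>p. (fst p $ i, lam i (snd p $ i))) ` ?S \<subseteq> coords (J i) \<times> UNIV"
      by (auto simp: responses_def)
    have "ext_convex_on (coords (J i) \<times> UNIV)
        (\<lambda>p. maj_gap (J i) (\<phi> i) (xk $ i) (lam i (\<delta>k $ i)) (fst p) (snd p))"
      using phi_pcc by (intro ext_convex_on_maj_gap) auto
    from ext_convex_on_affine_comp[OF S pair image this]
    show ?thesis
      by simp
  qed
  have "ext_convex_on ?S (\<lambda>p. ereal (\<rho> k) * (\<Sum>i\<in>UNIV. ?gap i p))"
    using gap_convex rho by (intro ext_convex_on_cmult ext_convex_on_sum S)
  then have "ext_convex_on ?S (\<lambda>p. F p + ereal (\<rho> k) * (\<Sum>i\<in>UNIV. ?gap i p))"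
    by (rule ext_convex_on_add[OF S F(3)])
  moreover have "sub_objective J \<phi> lam F (\<rho> k) (it k)
      = (\<lambda>p. F p + ereal (\<rho> k) * (\<Sum>i\<in>UNIV. ?gap i p))"
    by (auto simp: sub_objective_def it)
  ultimately show "ext_convex_on ?S (sub_objective J \<phi> lam F (\<rho> k) (it k))"
    by simp
next
  have "sub_feasible J D = responses J \<times> D"
    by (auto simp: sub_feasible_def)
  then show "convex (sub_feasible J D :: ((real^'n^'h) \<times> (real^'t^'h)) set)"
    using D(3) by (simp add: convex_Times subspace_imp_convex subspace_responses)
qed

end
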